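(* There exists $n_0$ such that for every $n \ge n_0$ the following holds. If $H$ is any graph on $n$ vertices with no isolated vertices and with maximum degree $\Delta(H) \le \sqrt{n}/200$, then $$ex(n,H) = \binom{n-1}{2} + \delta(H) - 1,$$ where $\delta(H)$ denotes the minimum degree of $H$.
   Context: For a graph $H$, the extremal number $ex(n,H)$ is the maximum number of edges in a graph on $n$ vertices that does not contain a subgraph isomorphic to $H$. Here $H$ itself has $n$ vertices, so containing $H$ means containing it as a spanning subgraph. *)

theory Defs
  imports Complex_Main
begin

text \<open>Finite simple graphs: a vertex set together with a set of two-element subsets of it.\<close>

type_synonym 'a ugraph = "'a set \<times> 'a set set"

abbreviation verts :: "'a ugraph \<Rightarrow> 'a set" where "verts \<equiv> fst"
abbreviation edges :: "'a ugraph \<Rightarrow> 'a set set" where "edges \<equiv> snd"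

definition is_graph :: "'a ugraph \<Rightarrow> bool" where
  "is_graph G \<longleftrightarrow> finite (verts G) \<and> (\<forall>e \<in> edges G. e \<subseteq> verts G \<and> card e = 2)"

definition degree :: "'a ugraph \<Rightarrow> 'a \<Rightarrow> nat" where
  "degree G v = card {e \<in> edges G. v \<in> e}"

definition isolated :: "'a ugraph \<Rightarrow> 'a \<Rightarrow> bool" where
  "isolated G v \<longleftrightarrow> v \<in> verts G \<and> degree G v = 0"

text \<open>Both are meaningful only when the graph has at least one vertex.\<close>

definition max_degree :: "'a ugraph \<Rightarrow> nat" where
  "max_degree G = Max (degree G ` verts G)"

definition min_degree :: "'a ugraph \<Rightarrow> nat" where
  "min_degree G = Min (degree G ` verts G)"

definition subgraph :: "'a ugraph \<Rightarrow> 'a ugraph \<Rightarrow> bool" where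
  "subgraph K G \<longleftrightarrow> is_graph K \<and> verts K \<subseteq> verts G \<and> edges K \<subseteq> edges G"

definition isomorphic :: "'a ugraph \<Rightarrow> 'b ugraph \<Rightarrow> bool" where
  "isomorphic G H \<longleftrightarrow>
     (\<exists>f. bij_betw f (verts G) (verts H) \<and> edges H = (\<lambda>e. f ` e) ` edges G)"

definition contains_copy :: "'a ugraph \<Rightarrow> 'b ugraph \<Rightarrow> bool" where
  "contains_copy G H \<longleftrightarrow> (\<exists>K. subgraph K G \<and> isomorphic K H)"

text \<open>Host graphs have natural numbers as vertices, which loses nothing up to isomorphism.
  The set of edge counts is bounded by \<open>n choose 2\<close>, hence finite; it is nonempty as soon
  as \<open>H\<close> has an edge (the edgeless graph on \<open>n\<close> vertices qualifies).\<close>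

definition ex :: "nat \<Rightarrow> 'b ugraph \<Rightarrow> nat" where
  "ex n H = Max {card (edges G) | G :: nat ugraph.
     is_graph G \<and> card (verts G) = n \<and> \<not> contains_copy G H}"

end

theory Submission
  imports Defs "HOL-Combinatorics.Transposition"
begin

text \<open>For the upper bound one has to pack \<open>H\<close> with the complement \<open>F\<close> of a dense graph, which has at most
  \<open>n - 1 - \<delta>(H)\<close> edges. Put \<open>D = \<Delta>(H)\<close>, so that \<open>40000 D\<^sup>2 \<le> n\<close>, and call a vertex of \<open>F\<close> heavy
  if its degree exceeds \<open>2000 D\<close>. A vertex \<open>x\<^sub>1\<close> of minimum degree of \<open>H\<close> goes to a vertex \<open>v\<^sub>1\<close> of
  maximum degree of \<open>F\<close>, and its neighbours go to an independent set of light non-neighbours of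
  \<open>v\<^sub>1\<close>, which exists because \<open>F - v\<^sub>1\<close> has few edges. The other heavy vertices (of degree at most
  \<open>n/2\<close> each and \<open>2n\<close> in total) receive pairwise non-adjacent vertices of \<open>H\<close> far from \<open>x\<^sub>1\<close>, chosen
  greedily so that the heavy degrees seen from any vertex of \<open>H\<close> sum to at most \<open>3n/4\<close>.
  Everything else is placed by the Sauer--Spencer swapping argument. The extremal graph is a complete
  graph on \<open>n - 1\<close> vertices with one further vertex of degree \<open>\<delta>(H) - 1\<close>.\<close>

section \<open>Neighbourhoods and degrees in finite simple graphs\<close>

definition nbhd :: "'a ugraph \<Rightarrow> 'a \<Rightarrow> 'a set" where
  "nbhd G v = {u. {v, u} \<in> edges G}"

lemma nbhd_sym: "u \<in> nbhd G v \<longleftrightarrow> v \<in> nbhd G u"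
  by (simp add: nbhd_def insert_commute)

lemma finite_edges:
  assumes "is_graph G" shows "finite (edges G)"
proof (rule finite_subset)
  show "edges G \<subseteq> Pow (verts G)" using assms by (auto simp: is_graph_def)
  show "finite (Pow (verts G))" using assms by (simp add: is_graph_def)
qed

lemma nbhd_subset: "is_graph G \<Longrightarrow> nbhd G v \<subseteq> verts G"
  by (auto simp: nbhd_def is_graph_def)

lemma finite_nbhd: "is_graph G \<Longrightarrow> finite (nbhd G v)"
  by (meson finite_subset is_graph_def nbhd_subset)

lemma nbhd_irrefl: "is_graph G \<Longrightarrow> v \<notin> nbhd G v"
  by (auto simp: nbhd_def is_graph_def)

lemma edge_cases:
  assumes "is_graph G" "e \<in> edges G"
  obtains u v where "e = {u, v}" "u \<noteq> v" "u \<in> verts G" "v \<in> verts G" "v \<in> nbhd G u"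
  using assms by (auto simp: is_graph_def nbhd_def card_2_iff)

lemma degree_nbhd:
  assumes "is_graph G" shows "degree G v = card (nbhd G v)"
proof -
  have "bij_betw (\<lambda>u. {v, u}) (nbhd G v) {e \<in> edges G. v \<in> e}"
  proof (rule bij_betw_imageI)
    show "inj_on (\<lambda>u. {v, u}) (nbhd G v)"
      by (auto simp: inj_on_def doubleton_eq_iff)
    show "(\<lambda>u. {v, u}) ` nbhd G v = {e \<in> edges G. v \<in> e}"
    proof
      show "{e \<in> edges G. v \<in> e} \<subseteq> (\<lambda>u. {v, u}) ` nbhd G v"
      proof
        fix e assume "e \<in> {e \<in> edges G. v \<in> e}"
        then have e: "e \<in> edges G" "v \<in> e" by auto
        then have "card e = 2" using assms by (simp add: is_graph_def)
        then obtain u where "e = {v, u}" using e(2) by (auto simp: card_2_iff insert_commute)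
        then show "e \<in> (\<lambda>u. {v, u}) ` nbhd G v" using e by (auto simp: nbhd_def)
      qed
    qed (auto simp: nbhd_def)
  qed
  then show ?thesis by (simp add: degree_def bij_betw_same_card)
qed

section \<open>Incidence counting and independent sets\<close>

text \<open>Each edge is counted once per endpoint in \<open>B\<close>, hence at most twice. This
  serves both to compare \<open>card B\<close> with the number of edges meeting \<open>B\<close> and
  to bound the total degree of the heavy vertices.\<close>

lemma sum_incident_le:
  assumes "finite B" "finite E" "\<And>e. e \<in> E \<Longrightarrow> card e = 2"
  shows "(\<Sum>b\<in>B. card {e \<in> E. b \<in> e}) \<le> 2 * card {e \<in> E. e \<inter> B \<noteq> {}}"
proof -
  have "(\<Sum>b\<in>B. card {e \<in> E. b \<in> e}) = (\<Sum>b\<in>B. \<Sum>e\<in>{e \<in> E. b \<in> e}. 1)" by simp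
  also have "\<dots> = (\<Sum>e\<in>E. \<Sum>b\<in>{b \<in> B. b \<in> e}. 1)"
    by (rule sum.swap_restrict) (use assms in auto)
  also have "\<dots> \<le> (\<Sum>e\<in>E. if e \<inter> B \<noteq> {} then 2 else 0)"
  proof (rule sum_mono)
    fix e assume e: "e \<in> E"
    have "finite e" using assms(3)[OF e] by (metis card.infinite zero_neq_numeral)
    then have "card (e \<inter> B) \<le> 2" using assms(3)[OF e] card_mono[of e "e \<inter> B"] by auto
    moreover have eq: "{b \<in> B. b \<in> e} = e \<inter> B" by auto
    ultimately show "(\<Sum>b\<in>{b \<in> B. b \<in> e}. 1::nat) \<le> (if e \<inter> B \<noteq> {} then 2 else 0)"
      unfolding eq by (cases "e \<inter> B = {}") simp_all
  qed
  also have "\<dots> = 2 * card {e \<in> E. e \<inter> B \<noteq> {}}"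
    using assms(2) by (simp add: sum.If_cases Int_def)
  finally show ?thesis .
qed

text \<open>Deleting a cover of \<open>E\<close> that contains \<open>B\<close> costs at most \<open>card E\<close> vertices: \<open>B\<close> meets at least
  \<open>card B\<close> edges, and one endpoint suffices for each of the others.\<close>

lemma independent_set_avoiding:
  assumes fin: "finite E" "finite W" "finite B"
    and two: "\<And>e. e \<in> E \<Longrightarrow> card e = 2"
    and B: "\<And>b. b \<in> B \<Longrightarrow> 2 \<le> card {e \<in> E. b \<in> e}"
    and card: "card E + d \<le> card W"
  obtains I where "I \<subseteq> W - B" "card I = d" "\<And>e. e \<in> E \<Longrightarrow> \<not> e \<subseteq> I"
proof -
  \<comment> \<open>One endpoint of each edge is selected, so that \<open>C\<close> below covers
    \<open>E\<close>: edges meeting \<open>B\<close> through \<open>B\<close>, the others through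
    \<open>c\<close>.\<close>
  define c :: "'a set \<Rightarrow> 'a" where "c e = (SOME x. x \<in> e)" for e
  have c: "c e \<in> e" if "e \<in> E" for e
    using two[OF that] unfolding c_def by (metis card.empty ex_in_conv someI_ex zero_neq_numeral)
  define E0 where "E0 = {e \<in> E. e \<inter> B = {}}"
  define E1 where "E1 = {e \<in> E. e \<inter> B \<noteq> {}}"
  define C where "C = B \<union> c ` E0"
  have "2 * card B = (\<Sum>b\<in>B. 2)" by simp
  also have "\<dots> \<le> (\<Sum>b\<in>B. card {e \<in> E. b \<in> e})" by (rule sum_mono) (rule B)
  also have "\<dots> \<le> 2 * card E1" unfolding E1_def by (rule sum_incident_le) (use fin two in auto)
  finally have "card B \<le> card E1" by simp
  moreover have "card E = card E0 + card E1"
  proof -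
    have "E = E0 \<union> E1" "E0 \<inter> E1 = {}" by (auto simp: E0_def E1_def)
    moreover have "finite E0" "finite E1" using fin(1) by (simp_all add: E0_def E1_def)
    ultimately show ?thesis by (simp add: card_Un_disjoint)
  qed
  moreover have "card C \<le> card B + card E0"
    using card_Un_le[of B "c ` E0"] card_image_le[of E0 c] fin(1) by (simp add: C_def E0_def)
  ultimately have "card C + d \<le> card W" using card by linarith
  moreover have "finite C" using fin by (auto simp: C_def E0_def)
  ultimately have "d \<le> card (W - C)"
    using diff_card_le_card_Diff[of C W] by linarith
  then obtain I where I: "I \<subseteq> W - C" "card I = d" by (meson obtain_subset_with_card_n)
  show thesis
  proof
    show "I \<subseteq> W - B" "card I = d" using I by (auto simp: C_def)
    show "\<not> e \<subseteq> I" if e: "e \<in> E" for e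
    proof
      assume "e \<subseteq> I"
      then have "e \<inter> C = {}" using I by auto
      then show False using c[OF e] e by (auto simp: C_def E0_def)
    qed
  qed
qed

section \<open>Completing a partial placement and removing conflicts by swaps\<close>

text \<open>The two complements have equal size, so any bijection between them completes
  \<open>p\<close>. This supplies the starting bijection for the swapping argument.\<close>

lemma extend_injection:
  assumes "finite A" "card A = card C" "finite C" "P \<subseteq> A" "inj_on p P" "p ` P \<subseteq> C"
  obtains f where "bij_betw f A C" "\<And>x. x \<in> P \<Longrightarrow> f x = p x"
proof -
  have "card (A - P) = card (C - p ` P)"
    using assms by (simp add: card_Diff_subset finite_subset card_image)
  then obtain q where q: "bij_betw q (A - P) (C - p ` P)"
    using assms finite_same_card_bij[of "A - P" "C - p ` P"] by auto
  define f where "f x = (if x \<in> P then p x else q x)" for x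
  have "bij_betw f P (p ` P)"
    using assms(5) by (auto simp: bij_betw_def f_def inj_on_def)
  moreover have "bij_betw f (A - P) (C - p ` P)"
    using q by (subst bij_betw_cong[of _ _ q]) (auto simp: f_def)
  ultimately have "bij_betw f (P \<union> (A - P)) (p ` P \<union> (C - p ` P))"
    by (rule bij_betw_combine) auto
  moreover have "P \<union> (A - P) = A" "p ` P \<union> (C - p ` P) = C" using assms by auto
  ultimately show thesis using that[of f] by (simp add: f_def)
qed

text \<open>The Sauer--Spencer argument: in an extension with the fewest conflicts, swapping the image of
  a conflicting vertex with a suitable other image would remove a conflict.\<close>

lemma packing_extend:
  fixes H :: "'a ugraph" and F :: "'b ugraph"
  assumes H: "is_graph H" and F: "is_graph F"
    and f: "bij_betw f (verts H) (verts F)"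
    and P: "P \<subseteq> verts H"
    and indep: "\<And>x y. x \<in> P \<Longrightarrow> y \<in> P \<Longrightarrow> {x, y} \<in> edges H \<Longrightarrow> {f x, f y} \<notin> edges F"
    and D: "\<And>v. degree H v \<le> D"
    and room: "\<And>g u. bij_betw g (verts H) (verts F) \<Longrightarrow> (\<And>x. x \<in> P \<Longrightarrow> g x = f x) \<Longrightarrow>
        u \<in> verts H - P \<Longrightarrow>
        card P + (\<Sum>z\<in>nbhd H u. degree F (g z)) + degree F (g u) * D + 1 < card (verts H)"
  obtains g where "bij_betw g (verts H) (verts F)" "\<And>e. e \<in> edges H \<Longrightarrow> g ` e \<notin> edges F"
proof -
  define ext where "ext g \<longleftrightarrow> bij_betw g (verts H) (verts F) \<and> (\<forall>x\<in>P. g x = f x)" for g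
  \<comment> \<open>Conflicts are ordered pairs, so each one is counted twice; this is harmless,
    since only minimality of the count matters.\<close>
  define bad where "bad g = {(a, b). {a, b} \<in> edges H \<and> {g a, g b} \<in> edges F}" for g :: "'a \<Rightarrow> 'b"
  have finV: "finite (verts H)" using H by (simp add: is_graph_def)
  have finbad: "finite (bad g)" for g
    by (rule finite_subset[of _ "verts H \<times> verts H"])
      (use H in \<open>auto simp: bad_def is_graph_def\<close>)
  have "ext f" using f by (simp add: ext_def)
  then obtain g where g: "ext g" and min: "\<And>g'. ext g' \<Longrightarrow> card (bad g) \<le> card (bad g')"
    using ex_has_least_nat[of ext f "\<lambda>g. card (bad g)"] by blast
  have gb: "bij_betw g (verts H) (verts F)" and gP: "\<And>x. x \<in> P \<Longrightarrow> g x = f x"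
    using g by (auto simp: ext_def)
  have "bad g = {}"
  proof (rule ccontr)
    assume "bad g \<noteq> {}"
    then obtain a b where ab: "{a, b} \<in> edges H" "{g a, g b} \<in> edges F" by (auto simp: bad_def)
    have "a \<in> verts H" "b \<in> verts H" using ab(1) H by (auto simp: is_graph_def)
    \<comment> \<open>There is no conflict inside \<open>P\<close>, so some endpoint
      \<open>u\<close> of the conflict is free to move.\<close>
    moreover have "a \<notin> P \<or> b \<notin> P" using indep[of a b] ab gP by auto
    moreover have "{b, a} \<in> edges H" "{g b, g a} \<in> edges F" using ab by (simp_all add: insert_commute)
    ultimately obtain u z where uz: "{u, z} \<in> edges H" "{g u, g z} \<in> edges F" "u \<in> verts H - P"
      using ab by blast
    \<comment> \<open>Forbidden swap partners: for \<open>w\<close> in \<open>X\<close> the image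
      \<open>g w\<close> would conflict when moved to \<open>u\<close>, and for \<open>w\<close> in
      \<open>Y\<close> the image \<open>g u\<close> would conflict when moved to
      \<open>w\<close>.\<close>
    define X where "X = {w \<in> verts H. \<exists>y\<in>nbhd H u. g w \<in> nbhd F (g y)}"
    define Y where "Y = {w \<in> verts H. \<exists>y\<in>verts H. g y \<in> nbhd F (g u) \<and> w \<in> nbhd H y}"
    have injg: "inj_on g (verts H)" using gb by (simp add: bij_betw_def)
    have "card X = card (g ` X)"
      by (rule card_image[symmetric], rule inj_on_subset[OF injg]) (auto simp: X_def)
    also have "\<dots> \<le> card (\<Union>y\<in>nbhd H u. nbhd F (g y))"
      by (rule card_mono) (auto simp: X_def finite_nbhd H F)
    also have "\<dots> \<le> (\<Sum>y\<in>nbhd H u. card (nbhd F (g y)))"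
      by (rule card_UN_le) (rule finite_nbhd[OF H])
    finally have X: "card X \<le> (\<Sum>y\<in>nbhd H u. degree F (g y))" by (simp add: degree_nbhd[OF F])
    define Q where "Q = {y \<in> verts H. g y \<in> nbhd F (g u)}"
    have finQ: "finite Q" using finV by (simp add: Q_def)
    have "card Q = card (g ` Q)"
      by (rule card_image[symmetric], rule inj_on_subset[OF injg]) (auto simp: Q_def)
    also have "\<dots> \<le> degree F (g u)" unfolding degree_nbhd[OF F]
      by (rule card_mono) (auto simp: Q_def finite_nbhd F)
    finally have Q: "card Q \<le> degree F (g u)" .
    have "card Y \<le> card (\<Union>y\<in>Q. nbhd H y)"
      by (rule card_mono) (auto simp: Y_def Q_def finite_nbhd[OF H] finV)
    also have "\<dots> \<le> (\<Sum>y\<in>Q. card (nbhd H y))" by (rule card_UN_le) (rule finQ)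
    also have "\<dots> \<le> (\<Sum>y\<in>Q. D)"
      by (rule sum_mono) (metis D degree_nbhd[OF H])
    also have "\<dots> \<le> degree F (g u) * D" using Q by simp
    finally have Y: "card Y \<le> degree F (g u) * D" .
    \<comment> \<open>The vertex \<open>z\<close> is excluded as well: swapping \<open>u\<close>
      with \<open>z\<close> would keep the conflict between them.\<close>
    have "card (P \<union> X \<union> Y \<union> {z}) \<le> card P + card X + card Y + 1"
      using card_Un_le[of "P \<union> X \<union> Y" "{z}"] card_Un_le[of "P \<union> X" Y] card_Un_le[of P X]
      by simp
    then have "card (P \<union> X \<union> Y \<union> {z}) < card (verts H)"
      using X Y room[OF gb gP uz(3)] by linarith
    then have "\<not> verts H \<subseteq> P \<union> X \<union> Y \<union> {z}"
      using card_mono[of "P \<union> X \<union> Y \<union> {z}" "verts H"] finV P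
      by (auto simp: X_def Y_def intro: finite_subset)
    then obtain w where w: "w \<in> verts H" "w \<notin> P" "w \<notin> X" "w \<notin> Y" "w \<noteq> z" by auto
    have "u \<in> X" using uz by (auto simp: X_def nbhd_def insert_commute)
    then have "w \<noteq> u" using w by auto
    define g' where "g' = g \<circ> transpose u w"
    have g'_simps: "g' u = g w" "g' w = g u" "\<And>x. x \<noteq> u \<Longrightarrow> x \<noteq> w \<Longrightarrow> g' x = g x"
      by (auto simp: g'_def transpose_def)
    have "bij_betw (transpose u w) (verts H) (verts H)"
      using w uz by (simp add: bij_betw_transpose_iff)
    then have "bij_betw g' (verts H) (verts F)"
      unfolding g'_def using gb by (rule bij_betw_trans)
    moreover have "g' x = f x" if "x \<in> P" for x
    proof -
      have "x \<noteq> u" "x \<noteq> w" using that w(2) uz(3) by auto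
      then show ?thesis using g'_simps(3) gP that by simp
    qed
    ultimately have "ext g'" by (simp add: ext_def)
    have no_u: "{g' u, g' y} \<notin> edges F" if "{u, y} \<in> edges H" "y \<noteq> w" for y
    proof -
      have "y \<noteq> u" using that nbhd_irrefl[OF H, of u] by (auto simp: nbhd_def)
      then have "g' y = g y" using that by (simp add: g'_simps)
      moreover have "y \<in> nbhd H u" using that by (simp add: nbhd_def)
      ultimately show ?thesis using w(1,3) g'_simps(1)
        by (auto simp: X_def nbhd_def insert_commute)
    qed
    have no_w: "{g' w, g' y} \<notin> edges F" if "{w, y} \<in> edges H" "y \<noteq> u" for y
    proof -
      have "y \<noteq> w" using that nbhd_irrefl[OF H, of w] by (auto simp: nbhd_def)
      then have "g' y = g y" using that by (simp add: g'_simps)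
      moreover have "y \<in> verts H" "w \<in> nbhd H y"
        using that H by (auto simp: nbhd_def is_graph_def insert_commute)
      ultimately show ?thesis using w(1,4) g'_simps(2)
        by (auto simp: Y_def nbhd_def insert_commute)
    qed
    \<comment> \<open>A conflict of \<open>g'\<close> touching \<open>u\<close> or \<open>w\<close>
      must join these two, and the swap preserves the image of that pair. So no conflict is new, and
      \<open>(u, z)\<close> has disappeared.\<close>
    have "bad g' \<subseteq> bad g - {(u, z)}"
    proof
      fix p assume "p \<in> bad g'"
      then obtain c d where p: "p = (c, d)" "{c, d} \<in> edges H" "{g' c, g' d} \<in> edges F"
        by (auto simp: bad_def)
      have cu: "d = w" if "c = u" using that no_u[of d] p by auto
      have du: "c = w" if "d = u" using that no_u[of c] p by (auto simp: insert_commute)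
      have cw: "d = u" if "c = w" using that no_w[of d] p by auto
      have dw: "c = u" if "d = w" using that no_w[of c] p by (auto simp: insert_commute)
      consider "c = u" | "c = w" | "c \<noteq> u" "c \<noteq> w" by blast
      then have "{g c, g d} \<in> edges F"
      proof cases
        case 1
        then show ?thesis using cu p g'_simps by (simp add: insert_commute)
      next
        case 2
        then show ?thesis using cw p g'_simps by (simp add: insert_commute)
      next
        case 3
        then have "d \<noteq> u" "d \<noteq> w" using du dw by blast+
        with 3 show ?thesis using p g'_simps by simp
      qed
      moreover have "p \<noteq> (u, z)"
      proof
        assume "p = (u, z)"
        then have "d = w" "d = z" using cu p(1) by simp_all
        then show False using w(5) by simp
      qed
      ultimately show "p \<in> bad g - {(u, z)}" using p by (auto simp: bad_def)
    qed
    moreover have "(u, z) \<in> bad g" using uz by (simp add: bad_def)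
    ultimately have "bad g' \<subset> bad g" by auto
    then have "card (bad g') < card (bad g)" by (rule psubset_card_mono[OF finbad])
    then show False using min[OF \<open>ext g'\<close>] by linarith
  qed
  then have "g ` e \<notin> edges F" if "e \<in> edges H" for e
    using that by (auto simp: bad_def nbhd_def elim!: edge_cases[OF H])
  then show thesis using that gb by blast
qed

section \<open>Spreading the heavy vertices\<close>

text \<open>Greedy choice: by double counting, at most \<open>8 D\<close> vertices ever have load above \<open>n/4\<close>, and a new
  vertex is chosen away from their neighbourhoods.\<close>

lemma spread_embedding:
  fixes H :: "'a ugraph" and c :: "'b \<Rightarrow> nat"
  assumes H: "is_graph H" and n: "card (verts H) = n" and D: "\<And>v. degree H v \<le> D"
    and "finite B" and "sum c B \<le> 2 * n" and "\<And>b. b \<in> B \<Longrightarrow> 2 * c b \<le> n"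
    and Z: "finite Z" and "card Z + card B * (D + 1) + 8 * D * D < n"
  shows "\<exists>h. inj_on h B \<and> h ` B \<subseteq> verts H - Z \<and>
      (\<forall>b\<in>B. \<forall>b'\<in>B. {h b, h b'} \<notin> edges H) \<and>
      (\<forall>y. 4 * sum c {b \<in> B. y \<in> nbhd H (h b)} \<le> 3 * n)"
  using assms(4-6,8)
proof (induction B rule: finite_induct)
  case empty
  then show ?case by simp
next
  case (insert b B)
  have "sum c B \<le> 2 * n" "card Z + card B * (D + 1) + 8 * D * D < n"
    using insert by auto
  moreover have "\<And>b. b \<in> B \<Longrightarrow> 2 * c b \<le> n" using insert.prems(2) by simp
  ultimately obtain h where h: "inj_on h B" "h ` B \<subseteq> verts H - Z"
    "\<And>b b'. b \<in> B \<Longrightarrow> b' \<in> B \<Longrightarrow> {h b, h b'} \<notin> edges H"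
    "\<And>y. 4 * sum c {b \<in> B. y \<in> nbhd H (h b)} \<le> 3 * n"
    using insert.IH by blast
  have finV: "finite (verts H)" using H by (simp add: is_graph_def)
  define load where "load y = sum c {b \<in> B. y \<in> nbhd H (h b)}" for y
  \<comment> \<open>The threshold n/4 leaves room for one more weight, itself at most n/2, below the
    bound 3n/4.\<close>
  define bad where "bad = {y \<in> verts H. n < 4 * load y}"
  have finbad: "finite bad" using finV by (simp add: bad_def)
  have "n > 0" using insert.prems by linarith
  have "card bad * n = (\<Sum>y\<in>bad. n)" by simp
  also have "\<dots> \<le> (\<Sum>y\<in>bad. 4 * load y)" by (rule sum_mono) (simp add: bad_def)
  also have "\<dots> = 4 * (\<Sum>y\<in>bad. load y)" by (simp add: sum_distrib_left)
  also have "(\<Sum>y\<in>bad. load y) \<le> (\<Sum>y\<in>verts H. load y)"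
    by (rule sum_mono2) (auto simp: finV bad_def)
  \<comment> \<open>Exchanging the sums, each \<open>b\<close> contributes \<open>c b\<close> to at
    most \<open>D\<close> vertices, so the total load is at most \<open>2 * n * D\<close>.\<close>
  also have "\<dots> = (\<Sum>b\<in>B. \<Sum>y\<in>{y \<in> verts H. y \<in> nbhd H (h b)}. c b)"
    unfolding load_def by (rule sum.swap_restrict) (use finV insert in auto)
  also have "\<dots> \<le> (\<Sum>b\<in>B. D * c b)"
  proof (rule sum_mono)
    fix b
    have "{y \<in> verts H. y \<in> nbhd H (h b)} = nbhd H (h b)" using nbhd_subset[OF H] by auto
    then show "(\<Sum>y\<in>{y \<in> verts H. y \<in> nbhd H (h b)}. c b) \<le> D * c b"
      using D[of "h b"] by (simp add: degree_nbhd[OF H])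
  qed
  also have "\<dots> = D * sum c B" by (simp add: sum_distrib_left)
  also have "\<dots> \<le> D * (2 * n)" using \<open>sum c B \<le> 2 * n\<close> by simp
  finally have "card bad * n \<le> (8 * D) * n" by (simp add: algebra_simps)
  then have bad: "card bad \<le> 8 * D" using \<open>n > 0\<close> by simp
  have UN: "card (\<Union>y\<in>S. nbhd H y) \<le> card S * D" if "finite S" for S
  proof -
    have "card (\<Union>y\<in>S. nbhd H y) \<le> (\<Sum>y\<in>S. card (nbhd H y))" by (rule card_UN_le[OF that])
    also have "\<dots> \<le> (\<Sum>y\<in>S. D)" by (rule sum_mono) (metis D degree_nbhd[OF H])
    finally show ?thesis by simp
  qed
  \<comment> \<open>A new image outside \<open>X\<close> is fresh, non-adjacent to the earlier
    images, and adds no load to an overloaded vertex.\<close>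
  define X where "X = Z \<union> h ` B \<union> (\<Union>y\<in>h ` B. nbhd H y) \<union> (\<Union>y\<in>bad. nbhd H y)"
  have "card (h ` B) \<le> card B" using insert by (simp add: card_image_le)
  moreover have "card (\<Union>y\<in>h ` B. nbhd H y) \<le> card (h ` B) * D"
    by (rule UN) (use insert in auto)
  moreover have "card (\<Union>y\<in>bad. nbhd H y) \<le> card bad * D" by (rule UN[OF finbad])
  moreover have "card X \<le> card Z + card (h ` B) + card (\<Union>y\<in>h ` B. nbhd H y)
      + card (\<Union>y\<in>bad. nbhd H y)"
    unfolding X_def by (intro order.trans[OF card_Un_le] add_mono order.refl)
  ultimately have "card X \<le> card Z + card B + card B * D + 8 * D * D"
    using bad by (meson add_mono le_trans mult_le_mono1 order_refl)
  also have "\<dots> < n" using insert by simp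
  finally have "\<not> verts H \<subseteq> X"
    using card_mono[of X "verts H"] n insert Z finbad
    by (force simp: X_def finite_nbhd[OF H])
  then obtain x where x: "x \<in> verts H" "x \<notin> X" by auto
  define h' where "h' = h(b := x)"
  have h'B: "h' a = h a" if "a \<in> B" for a using that insert(2) by (auto simp: h'_def)
  have h'b: "h' b = x" by (simp add: h'_def)
  show ?case
  proof (intro exI[of _ h'] conjI allI)
    have "h' ` B = h ` B" using h'B by auto
    moreover have "inj_on h' B" using h(1) h'B by (simp add: inj_on_def)
    ultimately show "inj_on h' (insert b B)" "h' ` insert b B \<subseteq> verts H - Z"
      using x h(2) h'b insert(2) by (auto simp: X_def)
    have 1: "{x, h a} \<notin> edges H" if "a \<in> B" for a
      using x that by (auto simp: X_def nbhd_def insert_commute)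
    have 2: "{x} \<notin> edges H" using H by (auto simp: is_graph_def)
    show "\<forall>a\<in>insert b B. \<forall>a'\<in>insert b B. {h' a, h' a'} \<notin> edges H"
      using 1 2 h(3) h'B h'b by (auto simp: insert_commute)
    fix y
    let ?S = "{a \<in> B. y \<in> nbhd H (h a)}"
    show "4 * sum c {a \<in> insert b B. y \<in> nbhd H (h' a)} \<le> 3 * n"
    proof (cases "y \<in> nbhd H x")
      case True
      then have "{a \<in> insert b B. y \<in> nbhd H (h' a)} = insert b ?S" using h'B h'b by auto
      moreover have "b \<notin> ?S" "finite ?S" using insert by auto
      ultimately have eq: "sum c {a \<in> insert b B. y \<in> nbhd H (h' a)} = c b + load y"
        by (simp add: load_def)
      have "y \<notin> bad" using True x nbhd_sym[of y H x] by (auto simp: X_def)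
      moreover have "y \<in> verts H" using True nbhd_subset[OF H] by auto
      ultimately have "4 * load y \<le> n" by (simp add: bad_def)
      then show ?thesis using eq insert.prems(2)[of b] by simp
    next
      case False
      then have "{a \<in> insert b B. y \<in> nbhd H (h' a)} = ?S" using h'B h'b by auto
      then show ?thesis using h(4) by simp
    qed
  qed
qed

section \<open>Packing with a sparse graph\<close>

text \<open>Once the critical set \<open>P\<close> is placed, every vertex except \<open>x1\<close>
  and the preimages of \<open>B\<close> has an image of degree at most \<open>2000 * D\<close>,
  which leaves the room that swapping needs. Here \<open>x1\<close> is any vertex; the theorem takes
  one of minimum degree.\<close>

lemma sparse_packing:
  fixes H :: "'a ugraph" and F :: "'b ugraph"
  assumes H: "is_graph H" and F: "is_graph F"
    and n: "card (verts H) = n" "card (verts F) = n"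
    and D: "\<And>v. degree H v \<le> D" "1 \<le> D" "40000 * (D * D) \<le> n"
    and x1: "x1 \<in> verts H" and m: "card (edges F) + degree H x1 + 1 \<le> n"
  obtains g where "bij_betw g (verts H) (verts F)" "\<And>e. e \<in> edges H \<Longrightarrow> g ` e \<notin> edges F"
proof -
  have finVH: "finite (verts H)" and finVF: "finite (verts F)"
    using H F by (simp_all add: is_graph_def)
  note finE = finite_edges[OF F]
  have "D \<le> D * D" by simp
  then have Dn: "40000 * D \<le> n" using D(3) by linarith
  have "verts F \<noteq> {}" using n x1 finVH by force
  then have "Max (degree F ` verts F) \<in> degree F ` verts F" using finVF by simp
  then obtain v1 where v1: "v1 \<in> verts F" "degree F v1 = Max (degree F ` verts F)"
    by (metis imageE)
  have max: "degree F v \<le> degree F v1" if "v \<in> verts F" for v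
    using that v1 finVF by simp
  \<comment> \<open>The vertex \<open>v1\<close> is kept apart because its degree may exceed
    n/2.\<close>
  define B where "B = {v \<in> verts F. v \<noteq> v1 \<and> 2000 * D < degree F v}"
  define E' where "E' = {e \<in> edges F. v1 \<notin> e}"
  define W where "W = verts F - insert v1 (nbhd F v1)"
  have finB: "finite B" using finVF by (simp add: B_def)
  have finE': "finite E'" using finE by (simp add: E'_def)
  have finW: "finite W" using finVF by (simp add: W_def)
  have "card (insert v1 (nbhd F v1)) = Suc (degree F v1)"
    using finite_nbhd[OF F] nbhd_irrefl[OF F] by (simp add: degree_nbhd[OF F])
  moreover have "insert v1 (nbhd F v1) \<subseteq> verts F" using v1 nbhd_subset[OF F] by auto
  ultimately have "card W + Suc (degree F v1) = n"
    using n(2) finVF card_mono[of "verts F" "insert v1 (nbhd F v1)"]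
    unfolding W_def by (subst card_Diff_subset) (auto intro: finite_nbhd[OF F])
  moreover have cardE: "card (edges F) = card E' + degree F v1"
  proof -
    have "edges F = E' \<union> {e \<in> edges F. v1 \<in> e}" by (auto simp: E'_def)
    moreover have "card (E' \<union> {e \<in> edges F. v1 \<in> e}) = card E' + card {e \<in> edges F. v1 \<in> e}"
      by (rule card_Un_disjoint) (use finE in \<open>auto simp: E'_def\<close>)
    ultimately show ?thesis by (simp add: degree_def)
  qed
  \<comment> \<open>Deleting \<open>v1\<close> lowers both sides of \<open>m\<close> equally:
    \<open>E'\<close> loses its edges and \<open>W\<close> its neighbours.\<close>
  ultimately have cardW: "card E' + degree H x1 \<le> card W" using m by linarith
  \<comment> \<open>The extra 1 is for a possible edge from \<open>b\<close> to \<open>v1\<close>,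
    which \<open>E'\<close> omits.\<close>
  have degB: "degree F b \<le> card {e \<in> E'. b \<in> e} + 1" if "b \<in> B" for b
  proof -
    have "{e \<in> edges F. b \<in> e} \<subseteq> {e \<in> E'. b \<in> e} \<union> {{v1, b}}"
      using that F by (auto simp: E'_def B_def is_graph_def card_2_iff)
    then have "degree F b \<le> card ({e \<in> E'. b \<in> e} \<union> {{v1, b}})"
      unfolding degree_def by (rule card_mono[rotated]) (use finE' in auto)
    also have "\<dots> \<le> card {e \<in> E'. b \<in> e} + 1"
      using card_Un_le[of "{e \<in> E'. b \<in> e}" "{{v1, b}}"] by simp
    finally show ?thesis .
  qed
  have two: "card e = 2" if "e \<in> edges F" for e using F that by (auto simp: is_graph_def)
  have "2 \<le> card {e \<in> E'. b \<in> e}" if "b \<in> B" for b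
  proof -
    have "2000 * D < degree F b" using that by (simp add: B_def)
    then show ?thesis using degB[OF that] D(2) by linarith
  qed
  moreover have "card e = 2" if "e \<in> E'" for e using that two by (simp add: E'_def)
  ultimately obtain I where I: "I \<subseteq> W - B" "card I = degree H x1" "\<And>e. e \<in> E' \<Longrightarrow> \<not> e \<subseteq> I"
    using independent_set_avoiding[OF finE' finW finB _ _ cardW] by blast
  have "(\<Sum>b\<in>B. degree F b) \<le> 2 * card {e \<in> edges F. e \<inter> B \<noteq> {}}"
    unfolding degree_def by (rule sum_incident_le[OF finB finE two])
  also have "\<dots> \<le> 2 * card (edges F)" using finE by (simp add: card_mono)
  finally have sumB: "(\<Sum>b\<in>B. degree F b) \<le> 2 * n" using m by linarith
  \<comment> \<open>The degree of \<open>b\<close> is at most \<open>card E' + 1\<close> and at most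
    the degree of \<open>v1\<close>; these two bounds sum to \<open>card (edges F) + 1\<close>,
    which is at most \<open>n\<close>.\<close>
  have halfB: "2 * degree F b \<le> n" if "b \<in> B" for b
  proof -
    have "card {e \<in> E'. b \<in> e} \<le> card E'" by (rule card_mono) (use finE' in auto)
    moreover have "degree F b \<le> degree F v1" by (rule max) (use that in \<open>simp add: B_def\<close>)
    ultimately show ?thesis using degB[OF that] cardE m by linarith
  qed
  have "card B * (2000 * D) = (\<Sum>b\<in>B. 2000 * D)" by simp
  also have "\<dots> \<le> (\<Sum>b\<in>B. degree F b)" by (rule sum_mono) (auto simp: B_def)
  finally have cBD: "1000 * (card B * D) \<le> n" using sumB by simp
  have "card B \<le> card B * D" using D(2) by simp
  then have cB: "1000 * card B \<le> n" using cBD by linarith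
  \<comment> \<open>The ball of radius 2 around \<open>x1\<close>: preimages of heavy vertices
    outside it are not adjacent to \<open>x1\<close> or its neighbours.\<close>
  define Z where "Z = {x1} \<union> nbhd H x1 \<union> (\<Union>y\<in>nbhd H x1. nbhd H y)"
  have finZ: "finite Z" by (simp add: Z_def finite_nbhd[OF H])
  have "card (\<Union>y\<in>nbhd H x1. nbhd H y) \<le> (\<Sum>y\<in>nbhd H x1. card (nbhd H y))"
    by (rule card_UN_le) (rule finite_nbhd[OF H])
  also have "\<dots> \<le> (\<Sum>y\<in>nbhd H x1. D)" by (rule sum_mono) (metis D(1) degree_nbhd[OF H])
  also have "\<dots> \<le> D * D" using D(1)[of x1] by (simp add: degree_nbhd[OF H])
  finally have "card Z \<le> 1 + D + D * D"
    using card_Un_le[of "{x1} \<union> nbhd H x1" "\<Union>y\<in>nbhd H x1. nbhd H y"]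
      card_Un_le[of "{x1}" "nbhd H x1"] D(1)[of x1]
    unfolding Z_def by (simp add: degree_nbhd[OF H])
  \<comment> \<open>The \<open>B\<close> term is at most n/500, and the rest is about
    \<open>9 * D * D\<close>, a tiny fraction of \<open>n\<close>.\<close>
  then have "card Z + card B * (D + 1) + 8 * D * D < n"
    using cB cBD Dn D(2,3) by (simp add: algebra_simps)
  from spread_embedding[OF H n(1) D(1) finB sumB halfB finZ this]
  obtain h where h: "inj_on h B" "h ` B \<subseteq> verts H - Z"
      "\<And>b b'. b \<in> B \<Longrightarrow> b' \<in> B \<Longrightarrow> {h b, h b'} \<notin> edges H"
      "\<And>y. 4 * sum (degree F) {b \<in> B. y \<in> nbhd H (h b)} \<le> 3 * n"
    by blast
  have finI: "finite I" using I(1) finW by (auto intro: finite_subset)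
  obtain q where q: "bij_betw q (nbhd H x1) I"
    using finite_same_card_bij[OF finite_nbhd[OF H] finI, of x1] I(2)
    by (auto simp: degree_nbhd[OF H])
  define p where "p x = (if x = x1 then v1 else if x \<in> nbhd H x1 then q x else inv_into B h x)" for x
  define P where "P = {x1} \<union> nbhd H x1 \<union> h ` B"
  have p1: "p x1 = v1" by (simp add: p_def)
  have p2: "p y = q y" "q y \<in> I" if "y \<in> nbhd H x1" for y
    using that nbhd_irrefl[OF H, of x1] q by (auto simp: p_def bij_betw_def)
  have p3: "p (h b) = b" if "b \<in> B" for b
  proof -
    have "h b \<notin> Z" using h(2) that by auto
    then show ?thesis using that h(1) by (simp add: p_def Z_def)
  qed
  have injq: "inj_on q (nbhd H x1)" using q by (simp add: bij_betw_def)
  have v1I: "v1 \<notin> I" "v1 \<notin> B" "I \<inter> B = {}" using I(1) by (auto simp: W_def B_def)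
  have "inj_on p (nbhd H x1)" using injq p2(1) by (simp add: inj_on_def)
  moreover have "inj_on p (h ` B)" using p3 by (auto simp: inj_on_def)
  moreover have "p ` nbhd H x1 \<subseteq> I" "p ` h ` B \<subseteq> B" using p2 p3 by auto
  moreover have "p ` {x1} = {v1}" using p1 by simp
  moreover have "inj_on p (A \<union> A')"
    if "inj_on p A" "inj_on p A'" "p ` A \<subseteq> R" "p ` A' \<subseteq> R'" "R \<inter> R' = {}" for A A' R R'
    using that unfolding inj_on_Un by blast
  note Un = this
  ultimately have "inj_on p P" unfolding P_def using v1I
    by (intro Un[of "{x1} \<union> nbhd H x1" "h ` B" "{v1} \<union> I" B] Un[of "{x1}" "nbhd H x1" "{v1}" I]) auto
  moreover have "p ` P \<subseteq> verts F"
  proof -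
    have "I \<subseteq> verts F" "B \<subseteq> verts F" using I(1) by (auto simp: W_def B_def)
    then show ?thesis using p1 p2 p3 v1 by (auto simp: P_def)
  qed
  moreover have PH: "P \<subseteq> verts H" using x1 nbhd_subset[OF H] h(2) by (auto simp: P_def)
  ultimately obtain f where f: "bij_betw f (verts H) (verts F)" and fp: "\<And>x. x \<in> P \<Longrightarrow> f x = p x"
    using extend_injection[OF finVH _ finVF, of P p] n by metis
  have f1: "f x1 = v1" using fp[of x1] p1 by (simp add: P_def)
  have f2: "f y \<in> I" if "y \<in> nbhd H x1" for y using fp[of y] p2[OF that] that by (simp add: P_def)
  have f3: "f (h b) = b" if "b \<in> B" for b using fp[of "h b"] p3[OF that] that by (simp add: P_def)
  have star: "{v1, w} \<notin> edges F" if "w \<in> I" for w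
    using that I(1) by (auto simp: W_def nbhd_def)
  have hZ: "h b \<notin> Z" if "b \<in> B" for b using that h(2) by auto
  have indep: "{f x, f y} \<notin> edges F" if xy: "x \<in> P" "y \<in> P" "{x, y} \<in> edges H" for x y
  proof -
    have adj: "y \<in> nbhd H x" "x \<in> nbhd H y" using xy(3) by (auto simp: nbhd_def insert_commute)
    \<comment> \<open>Edges at \<open>x1\<close> go to non-neighbours of \<open>v1\<close>, and
      edges among its neighbours go into the independent set \<open>I\<close>. Edges from these
      neighbours to preimages of heavy vertices are excluded by \<open>Z\<close>, and edges between
      such preimages by the choice of \<open>h\<close>.\<close>
    consider "x = x1" | "y = x1" | "x \<in> nbhd H x1" "y \<in> nbhd H x1"
      | b where "b \<in> B" "x = h b" "y \<in> nbhd H x1" | b where "b \<in> B" "y = h b" "x \<in> nbhd H x1"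
      | b b' where "b \<in> B" "b' \<in> B" "x = h b" "y = h b'"
      using xy unfolding P_def by blast
    then show ?thesis
    proof cases
      case 1
      then show ?thesis using star f1 f2 adj by simp
    next
      case 2
      then show ?thesis using star[of "f x"] f1 f2[of x] adj by (simp add: insert_commute)
    next
      case 3
      then have "f x \<in> I" "f y \<in> I" using f2 by simp_all
      then have "{f x, f y} \<subseteq> I" "v1 \<notin> {f x, f y}" using v1I by auto
      then show ?thesis using I(3)[of "{f x, f y}"] by (auto simp: E'_def)
    next
      case 4
      then show ?thesis using hZ[of b] adj by (auto simp: Z_def)
    next
      case 5
      then show ?thesis using hZ[of b] adj by (auto simp: Z_def)
    next
      case 6
      then show ?thesis using h(3) xy by blast
    qed
  qed
  have "card P \<le> 1 + D + card B"
    using card_Un_le[of "{x1} \<union> nbhd H x1" "h ` B"] card_image_le[OF finB, of h]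
      card_Un_le[of "{x1}" "nbhd H x1"] D(1)[of x1]
    unfolding P_def by (simp add: degree_nbhd[OF H])
  have room: "card P + (\<Sum>z\<in>nbhd H u. degree F (g z)) + degree F (g u) * D + 1 < card (verts H)"
    if g: "bij_betw g (verts H) (verts F)" and gf: "\<And>x. x \<in> P \<Longrightarrow> g x = f x"
      and u: "u \<in> verts H - P" for g u
  proof -
    \<comment> \<open>Since \<open>g\<close> agrees with \<open>f\<close> on \<open>P\<close>, the
      vertex \<open>v1\<close> and all of \<open>B\<close> already have their preimages there; any
      other image is light.\<close>
    have small: "degree F (g z) \<le> 2000 * D" if z: "z \<in> verts H" "z \<noteq> x1" "z \<notin> h ` B" for z
    proof (rule ccontr)
      assume *: "\<not> ?thesis"
      have inj: "inj_on g (verts H)" and "g z \<in> verts F" using g z by (auto simp: bij_betw_def)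
      moreover have "g z \<noteq> v1"
        using inj_onD[OF inj, of z x1] gf[of x1] f1 z x1 by (auto simp: P_def)
      ultimately have gz: "g z \<in> B" using * by (simp add: B_def)
      then have "g (h (g z)) = g z" using gf[of "h (g z)"] f3 by (simp add: P_def)
      moreover have "h (g z) \<in> verts H" using gz h(2) by auto
      ultimately have "h (g z) = z" using inj_onD[OF inj] z by blast
      then show False using z(3) gz by (metis imageI)
    qed
    have gu: "degree F (g u) \<le> 2000 * D" by (rule small) (use u in \<open>auto simp: P_def\<close>)
    \<comment> \<open>Heavy neighbours are controlled by the load bound of \<open>h\<close>, the
      remaining ones by \<open>small\<close>.\<close>
    have "(\<Sum>z\<in>nbhd H u. degree F (g z))
        = (\<Sum>z\<in>nbhd H u \<inter> h ` B. degree F (g z)) + (\<Sum>z\<in>nbhd H u - h ` B. degree F (g z))"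
      by (rule sum.Int_Diff) (rule finite_nbhd[OF H])
    also have "(\<Sum>z\<in>nbhd H u \<inter> h ` B. degree F (g z))
        = sum (degree F) {b \<in> B. u \<in> nbhd H (h b)}"
    proof -
      have "nbhd H u \<inter> h ` B = h ` {b \<in> B. u \<in> nbhd H (h b)}"
        by (auto simp: nbhd_sym[of _ H u])
      moreover have "inj_on h {b \<in> B. u \<in> nbhd H (h b)}" using h(1) by (simp add: inj_on_def)
      moreover have "g (h b) = b" if "b \<in> B" for b using that f3 gf[of "h b"] by (simp add: P_def)
      ultimately show ?thesis by (simp add: sum.reindex)
    qed
    also have "(\<Sum>z\<in>nbhd H u - h ` B. degree F (g z)) \<le> (\<Sum>z\<in>nbhd H u - h ` B. 2000 * D)"
    proof (rule sum_mono)
      fix z assume z: "z \<in> nbhd H u - h ` B"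
      \<comment> \<open>As \<open>u\<close> lies outside \<open>P\<close>, it is not adjacent to
        \<open>x1\<close>; thus the possibly huge degree of \<open>v1\<close> never enters the
        sum.\<close>
      then have "z \<noteq> x1" using u nbhd_sym[of x1 H u] by (auto simp: P_def)
      then show "degree F (g z) \<le> 2000 * D" using z nbhd_subset[OF H] by (intro small) auto
    qed
    also have "\<dots> \<le> D * (2000 * D)"
    proof -
      have "card (nbhd H u - h ` B) \<le> card (nbhd H u)" by (rule card_mono) (auto simp: finite_nbhd[OF H])
      then show ?thesis using D(1)[of u] by (simp add: degree_nbhd[OF H])
    qed
    finally have "4 * (\<Sum>z\<in>nbhd H u. degree F (g z)) \<le> 3 * n + 8000 * (D * D)"
      using h(4)[of u] by simp
    moreover have "degree F (g u) * D \<le> 2000 * (D * D)"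
      using mult_le_mono1[OF gu, of D] by simp
    \<comment> \<open>After multiplication by 4 the main terms are
      \<open>3 * n + 16000 * (D * D)\<close>, at most 3.4n; the terms from \<open>card P\<close> and
      the constant add less than 0.01n.\<close>
    ultimately show ?thesis
      using \<open>card P \<le> 1 + D + card B\<close> cB Dn D(2,3) n(1) by linarith
  qed
  show thesis
    by (rule packing_extend[OF H F f PH indep D(1) room]) (use that in blast)+
qed

section \<open>Upper bound: dense graphs contain a copy\<close>

lemma isomorphic_degree:
  assumes f: "bij_betw f (verts G) (verts H)" "edges H = (\<lambda>e. f ` e) ` edges G"
    and G: "is_graph G" and v: "v \<in> verts G"
  shows "degree H (f v) = degree G v"
proof -
  have inj: "inj_on f (verts G)" using f by (simp add: bij_betw_def)
  have sub: "e \<subseteq> verts G" if "e \<in> edges G" for e using G that by (auto simp: is_graph_def)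
  have "{e \<in> edges H. f v \<in> e} = (\<lambda>e. f ` e) ` {e \<in> edges G. v \<in> e}"
    using inj_on_image_mem_iff[OF inj v] sub by (auto simp: f(2))
  moreover have "inj_on ((`) f) {e \<in> edges G. v \<in> e}"
    by (rule inj_on_subset[OF inj_on_image_Pow[OF inj]]) (use sub in auto)
  ultimately show ?thesis by (simp add: degree_def card_image)
qed

text \<open>The complement \<open>F\<close> has few enough edges for \<open>sparse_packing\<close>;
  a bijection sending no edge of \<open>H\<close> to an edge of \<open>F\<close> sends every edge of
  \<open>H\<close> into \<open>G\<close>.\<close>

lemma contains_copy_dense:
  fixes G :: "'b ugraph" and H :: "'a ugraph"
  assumes H: "is_graph H" and G: "is_graph G"
    and n: "card (verts H) = n" "card (verts G) = n"
    and D: "\<And>v. degree H v \<le> D" "1 \<le> D" "40000 * (D * D) \<le> n"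
    and x1: "x1 \<in> verts H" and m: "((n - 1) choose 2) + degree H x1 \<le> card (edges G)"
  shows "contains_copy G H"
proof -
  define A where "A = {e. e \<subseteq> verts G \<and> card e = 2}"
  define F where "F = (verts G, A - edges G)"
  have finVG: "finite (verts G)" and finVH: "finite (verts H)"
    using G H by (simp_all add: is_graph_def)
  have F: "is_graph F" using finVG by (simp add: is_graph_def F_def A_def)
  have "n > 0" using n x1 finVH card_gt_0_iff by blast
  then obtain k where k: "n = Suc k" by (cases n) auto
  have "card A = n choose 2" unfolding A_def using n_subsets[OF finVG] n by simp
  also have "\<dots> = ((n - 1) choose 2) + (n - 1)" by (simp add: k numeral_2_eq_2)
  finally have "card A = ((n - 1) choose 2) + (n - 1)" .
  moreover have "edges G \<subseteq> A" using G by (auto simp: is_graph_def A_def)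
  then have "card (edges F) + card (edges G) = card A"
    using card_Diff_subset[OF finite_edges[OF G], of A] card_mono[of A "edges G"] finVG
    by (simp add: F_def A_def)
  ultimately have "card (edges F) + degree H x1 + 1 \<le> n" using m \<open>n > 0\<close> by linarith
  moreover have "card (verts F) = n" using n by (simp add: F_def)
  ultimately obtain g where g: "bij_betw g (verts H) (verts F)"
      "\<And>e. e \<in> edges H \<Longrightarrow> g ` e \<notin> edges F"
    using sparse_packing[OF H F n(1) _ D x1] by blast
  define K where "K = (verts G, (\<lambda>e. g ` e) ` edges H)"
  have gb: "bij_betw g (verts H) (verts G)" using g(1) by (simp add: F_def)
  have img: "g ` e \<in> A" if "e \<in> edges H" for e
  proof -
    have e: "e \<subseteq> verts H" "card e = 2" using H that by (auto simp: is_graph_def)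
    have "card (g ` e) = card e"
      by (rule card_image) (use gb e in \<open>auto simp: bij_betw_def intro: inj_on_subset\<close>)
    then show ?thesis using gb e by (auto simp: A_def bij_betw_def)
  qed
  have "edges K \<subseteq> edges G" using g(2) img by (auto simp: K_def F_def)
  moreover have "is_graph K" using img finVG by (auto simp: is_graph_def K_def A_def)
  ultimately have K: "subgraph K G" by (simp add: subgraph_def K_def)
  \<comment> \<open>\<open>isomorphic\<close> asks for a map from the copy to \<open>H\<close>,
    hence the inverse of the packing.\<close>
  define g' where "g' = inv_into (verts H) g"
  have "bij_betw g' (verts K) (verts H)"
    using bij_betw_inv_into[OF gb] by (simp add: g'_def K_def)
  moreover have "g' ` g ` e = e" if "e \<in> edges H" for e
    using that H gb unfolding g'_def is_graph_def bij_betw_def by (intro inv_into_image_cancel) auto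
  then have "edges H = (\<lambda>e. g' ` e) ` edges K" by (simp add: K_def image_image)
  ultimately show ?thesis using K unfolding contains_copy_def isomorphic_def by blast
qed

text \<open>Outside \<open>verts H\<close> the degree is 0, so the bound holds for all
  \<open>v\<close>, as the packing lemmas assume.\<close>

lemma degree_le_max_degree:
  assumes "is_graph H" shows "degree H v \<le> max_degree H"
proof (cases "v \<in> verts H")
  case True
  then show ?thesis using assms by (simp add: max_degree_def is_graph_def)
next
  case False
  then have "{e \<in> edges H. v \<in> e} = {}" using assms by (auto simp: is_graph_def)
  then show ?thesis by (simp add: degree_def del: Collect_empty_eq)
qed

section \<open>Lower bound: the extremal graph\<close>

text \<open>A copy of \<open>H\<close> would span \<open>G\<close> and so use the vertex
  \<open>k\<close>, whose degree is below the minimum degree of \<open>H\<close>.\<close>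

lemma dense_graph_without_copy:
  fixes H :: "'a ugraph"
  assumes H: "is_graph H" and n: "card (verts H) = n" "n \<ge> 1"
    and d: "1 \<le> min_degree H" "min_degree H \<le> n"
  obtains G :: "nat ugraph" where "is_graph G" "card (verts G) = n"
    "card (edges G) = ((n - 1) choose 2) + (min_degree H - 1)" "\<not> contains_copy G H"
proof -
  define k where "k = n - 1"
  define d where "d = min_degree H - 1"
  \<comment> \<open>This places the \<open>d\<close> neighbours of \<open>k\<close> inside the
    clique on \<open>{..<k}\<close>.\<close>
  have dk: "d \<le> k" using d by (simp add: d_def k_def)
  define E1 where "E1 = {e. e \<subseteq> {..<k} \<and> card e = 2}"
  define E2 where "E2 = (\<lambda>i. {k, i}) ` {..<d}"
  define G where "G = ({..k}, E1 \<union> E2)"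
  have "card {k, i} = 2" if "i < d" for i using that dk by simp
  then have G: "is_graph G" using dk by (auto simp: is_graph_def G_def E1_def E2_def)
  have vG: "card (verts G) = n" using n by (simp add: G_def k_def)
  have E2: "card E2 = d"
    unfolding E2_def by (subst card_image) (auto simp: inj_on_def doubleton_eq_iff)
  have "card (edges G) = card E1 + card E2"
    unfolding G_def snd_conv by (rule card_Un_disjoint) (auto simp: E1_def E2_def)
  also have "card E1 = k choose 2" unfolding E1_def using n_subsets[of "{..<k}" 2] by simp
  finally have cG: "card (edges G) = ((n - 1) choose 2) + (min_degree H - 1)"
    using E2 by (simp add: k_def d_def)
  have "\<not> contains_copy G H"
  proof
    assume "contains_copy G H"
    then obtain K f where K: "is_graph K" "verts K \<subseteq> verts G" "edges K \<subseteq> edges G"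
      and f: "bij_betw f (verts K) (verts H)" "edges H = (\<lambda>e. f ` e) ` edges K"
      by (auto simp: contains_copy_def isomorphic_def subgraph_def)
    have "card (verts K) = n" using bij_betw_same_card[OF f(1)] n by simp
    then have "verts K = verts G"
      using card_subset_eq[of "verts G" "verts K"] K vG by (simp add: G_def)
    then have k: "k \<in> verts K" by (simp add: G_def)
    have "degree K k \<le> card E2" unfolding degree_def
      by (rule card_mono) (use K(3) in \<open>auto simp: E2_def G_def E1_def\<close>)
    then have "degree H (f k) \<le> d" using isomorphic_degree[OF f K(1) k] E2 by simp
    moreover have "f k \<in> verts H" using f(1) k by (auto simp: bij_betw_def)
    then have "min_degree H \<le> degree H (f k)"
      using H by (simp add: min_degree_def is_graph_def)
    ultimately show False using d by (simp add: d_def)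
  qed
  then show thesis using that G vG cG by blast
qed

section \<open>The extremal number\<close>

theorem theorem1p1:
  shows "\<exists>n0 :: nat. \<forall>n \<ge> n0. \<forall>H :: 'a ugraph.
    is_graph H \<and> card (verts H) = n \<and> (\<nexists>v. isolated H v)
      \<and> real (max_degree H) \<le> sqrt (real n) / 200 \<longrightarrow>
    int (ex n H) = int ((n - 1) choose 2) + int (min_degree H) - 1"
proof (intro exI[of _ 1] allI impI, elim conjE)
  fix n and H :: "'a ugraph"
  \<comment> \<open>The threshold 1 only makes \<open>H\<close> nonempty; minimum degree at least 1
    and the degree bound then force \<open>n\<close> to be at least 40000.\<close>
  assume n: "1 \<le> n" and H: "is_graph H" and cH: "card (verts H) = n"
    and iso: "\<nexists>v. isolated H v" and max: "real (max_degree H) \<le> sqrt (real n) / 200"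
  define D where "D = max_degree H"
  have finVH: "finite (verts H)" using H by (simp add: is_graph_def)
  have ne: "verts H \<noteq> {}" using n cH by auto
  have D: "degree H v \<le> D" for v unfolding D_def by (rule degree_le_max_degree[OF H])
  have "200 * real D \<le> sqrt (real n)" using max by (simp add: D_def)
  then have "(200 * real D)\<^sup>2 \<le> real n"
    by (metis of_nat_0_le_iff mult_nonneg_nonneg power_mono real_sqrt_pow2 zero_le_numeral)
  then have "real (40000 * (D * D)) \<le> real n" by (simp add: power2_eq_square)
  then have Dn: "40000 * (D * D) \<le> n" by (simp only: of_nat_le_iff)
  have "min_degree H \<in> degree H ` verts H" using finVH ne by (simp add: min_degree_def)
  then obtain x1 where x1: "x1 \<in> verts H" "degree H x1 = min_degree H" by auto
  have d1: "1 \<le> min_degree H" using iso x1 by (metis isolated_def less_one not_le)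
  then have D1: "1 \<le> D" using D[of x1] x1 by simp
  have "D \<le> D * D" by simp
  then have dn: "min_degree H \<le> n" using D[of x1] x1 Dn by linarith
  let ?S = "{card (edges G) | G :: nat ugraph.
     is_graph G \<and> card (verts G) = n \<and> \<not> contains_copy G H}"
  let ?m = "((n - 1) choose 2) + (min_degree H - 1)"
  have le: "k \<le> ?m" if k: "k \<in> ?S" for k
  proof (rule ccontr)
    assume "\<not> k \<le> ?m"
    moreover obtain G :: "nat ugraph" where G: "k = card (edges G)" "is_graph G"
      "card (verts G) = n" "\<not> contains_copy G H" using k by blast
    ultimately have "((n - 1) choose 2) + degree H x1 \<le> card (edges G)" using x1 d1 by linarith
    then show False using contains_copy_dense[OF H G(2) cH G(3) D D1 Dn x1(1)] G(4) by blast
  qed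
  obtain G :: "nat ugraph" where "is_graph G" "card (verts G) = n" "card (edges G) = ?m"
      "\<not> contains_copy G H"
    using dense_graph_without_copy[OF H cH n d1 dn] .
  then have m: "?m \<in> ?S" by (intro CollectI exI[of _ G]) simp
  \<comment> \<open>The upper bound also yields the finiteness that \<open>Max\<close>
    requires.\<close>
  have "?S \<subseteq> {..?m}" using le by blast
  then have "finite ?S" by (rule finite_subset) simp
  then have "ex n H = ?m" unfolding ex_def using le m by (rule Max_eqI)
  then show "int (ex n H) = int ((n - 1) choose 2) + int (min_degree H) - 1" using d1 by simp
qed

end
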